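(* For every $(a,b,c)\in\mathbb R^3$, $$\|(a,b,c)\|_{\mathfrak O}=\begin{cases}\max\{|a|,|c|,|\tau^2a+c|,|a+\tau^2c|\},& b=0,\\[1ex] \Xi_1(a,b,c),& b\ne0\text{ and }\left(\frac ab,\frac cb\right)\in\mathcal I_1,\\[1ex] \Xi_2(a,b,c),& b\ne0\text{ and }\left(\frac ab,\frac cb\right)\in\mathcal I_2,\\[1ex] \Xi_3(a,b,c),& b\ne0\text{ and }\left(\frac ab,\frac cb\right)\in\mathcal I_3,\\[1ex] \Theta_1(a,b,c),& b\ne0\text{ and }\left(\frac ab,\frac cb\right)\in\mathcal E_1,\\[1ex] \Theta_3(a,b,c),& b\ne0\text{ and }\left(\frac ab,\frac cb\right)\in\mathcal E_3,\end{cases}$$ where the five regions cover $\mathbb R^2$ and, at a point lying in several regions, each of the corresponding formulas holds.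
   Context: Let $\tau=\sqrt2-1$ and $\mathfrak O=\{(x,y)\in[0,1]^2: x+y\le\sqrt2\}$. A triple $(a,b,c)\in\mathbb R^3$ is identified with the quadratic form $P(x,y)=ax^2+bxy+cy^2$, and $\|(a,b,c)\|_{\mathfrak O}=\sup\{|P(x,y)|:(x,y)\in\mathfrak O\}$. Define $$\Theta_1(a,b,c)=\max\{|c|,|\tau^2a+\tau b+c|\},\qquad \Theta_3(a,b,c)=\max\{|a|,|a+\tau b+\tau^2c|\},$$ $$\Xi_1(a,b,c)=\operatorname{sgn}(b)\left(c-\frac{b^2}{4a}\right),\quad \Xi_2(a,b,c)=\operatorname{sgn}(b)\,\frac{4ac-b^2}{2(a-b+c)},\quad \Xi_3(a,b,c)=\operatorname{sgn}(b)\left(a-\frac{b^2}{4c}\right),$$ with the continuous extension $\Xi_2(b/2,b,b/2)=|b|$. (Each $\Xi_j$ is used only when $b\neq0$ and $(a/b,c/b)\in\mathcal I_j$.) Let $\eta=\frac1{2\tau}=\frac{1+\sqrt2}2$, $\delta=\frac{1-\tau}2=1-\frac1{\sqrt2}$, and $$\Phi_1(u,v)=\max\{|v|,|\tau^2u+\tau+v|\},\qquad \Phi_3(u,v)=\max\{|u|,|u+\tau+\tau^2v|\}.$$ The regions are the following subsets of $\mathbb R^2$: $$\mathcal I_1=\{(u,v): u\le-\eta,\ v\ge -u+\tfrac1{4u}\},$$ $$\mathcal I_2=\{(u,v): v\le\delta+\tau u,\ u\le\delta+\tau v,\ 2u^2+6uv-2u-1\le0,\ 2v^2+6uv-2v-1\le0\},$$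 $$\mathcal I_3=\{(u,v): v\le-\eta,\ u\ge -v+\tfrac1{4v}\},$$ $$\mathcal E_0=\mathbb R^2\setminus(\operatorname{int}\mathcal I_1\cup\operatorname{int}\mathcal I_2\cup\operatorname{int}\mathcal I_3),$$ $$\mathcal E_1=\{(u,v)\in\mathcal E_0:\Phi_1(u,v)\ge\Phi_3(u,v)\},\qquad \mathcal E_3=\{(u,v)\in\mathcal E_0:\Phi_3(u,v)\ge\Phi_1(u,v)\}.$$ Here $\operatorname{int}$ denotes the topological interior in $\mathbb R^2$. *)

theory Defs
  imports "HOL-Analysis.Analysis"
begin

definition \<tau> :: real where
  "\<tau> = sqrt 2 - 1"

definition \<eta> :: real where
  "\<eta> = 1 / (2 * \<tau>)"

definition \<delta> :: real where
  "\<delta> = (1 - \<tau>) / 2"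

definition octagon :: "(real \<times> real) set" where
  "octagon = {(x, y). x \<in> {0..1} \<and> y \<in> {0..1} \<and> x + y \<le> sqrt 2}"

definition qform :: "real \<Rightarrow> real \<Rightarrow> real \<Rightarrow> real \<times> real \<Rightarrow> real" where
  "qform a b c = (\<lambda>(x, y). a * x\<^sup>2 + b * x * y + c * y\<^sup>2)"

text \<open>The octagon is compact and nonempty, so the supremum below is that of a nonempty
  bounded set of reals.\<close>

definition oct_norm :: "real \<Rightarrow> real \<Rightarrow> real \<Rightarrow> real" where
  "oct_norm a b c = (SUP p\<in>octagon. \<bar>qform a b c p\<bar>)"

definition \<Theta>1 :: "real \<Rightarrow> real \<Rightarrow> real \<Rightarrow> real" where
  "\<Theta>1 a b c = max \<bar>c\<bar> \<bar>\<tau>\<^sup>2 * a + \<tau> * b + c\<bar>"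

definition \<Theta>3 :: "real \<Rightarrow> real \<Rightarrow> real \<Rightarrow> real" where
  "\<Theta>3 a b c = max \<bar>a\<bar> \<bar>a + \<tau> * b + \<tau>\<^sup>2 * c\<bar>"

definition \<Xi>1 :: "real \<Rightarrow> real \<Rightarrow> real \<Rightarrow> real" where
  "\<Xi>1 a b c = sgn b * (c - b\<^sup>2 / (4 * a))"

text \<open>For \<open>b \<noteq> 0\<close>, the denominator \<open>a - b + c\<close> vanishes with \<open>(a / b, c / b) \<in> \<I>2\<close> only at
  \<open>a = c = b / 2\<close>, where the value is prescribed by continuous extension.\<close>

definition \<Xi>2 :: "real \<Rightarrow> real \<Rightarrow> real \<Rightarrow> real" where
  "\<Xi>2 a b c =
    (if a = b / 2 \<and> c = b / 2 then \<bar>b\<bar>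
     else sgn b * ((4 * a * c - b\<^sup>2) / (2 * (a - b + c))))"

definition \<Xi>3 :: "real \<Rightarrow> real \<Rightarrow> real \<Rightarrow> real" where
  "\<Xi>3 a b c = sgn b * (a - b\<^sup>2 / (4 * c))"

definition \<Phi>1 :: "real \<Rightarrow> real \<Rightarrow> real" where
  "\<Phi>1 u v = max \<bar>v\<bar> \<bar>\<tau>\<^sup>2 * u + \<tau> + v\<bar>"

definition \<Phi>3 :: "real \<Rightarrow> real \<Rightarrow> real" where
  "\<Phi>3 u v = max \<bar>u\<bar> \<bar>u + \<tau> + \<tau>\<^sup>2 * v\<bar>"

definition \<I>1 :: "(real \<times> real) set" where
  "\<I>1 = {(u, v). u \<le> - \<eta> \<and> v \<ge> - u + 1 / (4 * u)}"

definition \<I>2 :: "(real \<times> real) set" where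
  "\<I>2 = {(u, v). v \<le> \<delta> + \<tau> * u \<and> u \<le> \<delta> + \<tau> * v \<and>
     2 * u\<^sup>2 + 6 * u * v - 2 * u - 1 \<le> 0 \<and> 2 * v\<^sup>2 + 6 * u * v - 2 * v - 1 \<le> 0}"

definition \<I>3 :: "(real \<times> real) set" where
  "\<I>3 = {(u, v). v \<le> - \<eta> \<and> u \<ge> - v + 1 / (4 * v)}"

definition \<E>0 :: "(real \<times> real) set" where
  "\<E>0 = UNIV - (interior \<I>1 \<union> interior \<I>2 \<union> interior \<I>3)"

definition \<E>1 :: "(real \<times> real) set" where
  "\<E>1 = {(u, v). (u, v) \<in> \<E>0 \<and> \<Phi>1 u v \<ge> \<Phi>3 u v}"

definition \<E>3 :: "(real \<times> real) set" where
  "\<E>3 = {(u, v). (u, v) \<in> \<E>0 \<and> \<Phi>3 u v \<ge> \<Phi>1 u v}"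

end

theory Submission
  imports Defs
begin

text \<open>A quadratic form is homogeneous, so its size on the octagon is attained on the edges
  \<open>x = 1\<close>, \<open>y = 1\<close> and \<open>x + y = sqrt 2\<close>, along which it is a quadratic polynomial in one
  variable. After division by \<open>b\<close> one may take \<open>b \<ge> 0\<close>. Then a negative minimum never lies inside
  an edge, and an interior maximum lies only on an edge along which the slope changes from positive
  to negative; its value there is \<open>\<Xi>1\<close>, \<open>\<Xi>2\<close> or \<open>\<Xi>3\<close>. Each region \<open>\<I>j\<close> says that this interior
  maximum exists and is at least \<open>\<bar>a\<bar>\<close> or \<open>\<bar>c\<bar>\<close> as appropriate; outside the interiors of these
  regions the values at the four vertices decide.\<close>

section \<open>Arithmetic of the constants \<open>\<tau>\<close> and \<open>\<eta>\<close>\<close>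

lemma tau_sq: "\<tau>\<^sup>2 = 1 - 2 * \<tau>"
  by (simp add: \<tau>_def power2_eq_square algebra_simps)

text \<open>The second form catches a square of \<open>\<tau>\<close> inside right-nested products;
  together they let simplification reduce polynomials in \<open>\<tau>\<close> to degree
  one.\<close>

lemma tau_mult_tau: "\<tau> * \<tau> = 1 - 2 * \<tau>" "\<tau> * (\<tau> * x) = x - 2 * (\<tau> * x)"
proof -
  show "\<tau> * \<tau> = 1 - 2 * \<tau>"
    using tau_sq by (simp add: power2_eq_square)
  then have "(\<tau> * \<tau>) * x = (1 - 2 * \<tau>) * x" by simp
  then show "\<tau> * (\<tau> * x) = x - 2 * (\<tau> * x)" by (simp add: algebra_simps)
qed

lemma sqrt2_eq: "sqrt 2 = 1 + \<tau>"
  by (simp add: \<tau>_def)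

lemma tau_gt: "2 / 5 < \<tau>"
  unfolding \<tau>_def using real_less_rsqrt[of "7/5" 2] by (simp add: power2_eq_square)

lemma tau_lt: "\<tau> < 1 / 2"
  unfolding \<tau>_def using real_less_lsqrt[of "3/2" 2] by (simp add: power2_eq_square)

lemma eta_eq: "\<eta> = 1 + \<tau> / 2"
proof -
  have "(1 + \<tau> / 2) * (2 * \<tau>) = 1"
    by (simp add: field_simps tau_mult_tau)
  then show ?thesis
    using tau_gt unfolding \<eta>_def by (metis divide_eq_eq mult_eq_0_iff order_less_irrefl zero_neq_one)
qed

lemma eta_tau: "2 * \<tau> * \<eta> = 1"
  using tau_gt by (simp add: \<eta>_def)

section \<open>Quadratic polynomials on an interval\<close>

lemma quad_slope_between:
  fixes \<alpha> \<beta> l r t :: real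
  assumes "0 \<le> 2 * \<alpha> * l + \<beta>" "0 \<le> 2 * \<alpha> * r + \<beta>" "l \<le> t" "t \<le> r"
  shows "0 \<le> 2 * \<alpha> * t + \<beta>"
proof (cases "\<alpha> \<ge> 0")
  case True
  then have "\<alpha> * l \<le> \<alpha> * t" using assms by (simp add: mult_left_mono)
  then show ?thesis using assms(1) by linarith
next
  case False
  then have "\<alpha> * r \<le> \<alpha> * t" using assms by (simp add: mult_left_mono_neg)
  then show ?thesis using assms(2) by linarith
qed

text \<open>The difference of two values is the distance of the arguments times the mean of the
  slopes there, and an affine slope stays nonnegative between the ends.\<close>

lemma quad_mono:
  fixes \<alpha> \<beta> \<gamma> l r t :: real
  assumes "0 \<le> 2 * \<alpha> * l + \<beta>" "0 \<le> 2 * \<alpha> * r + \<beta>" "l \<le> t" "t \<le> r"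
  shows "\<alpha> * l\<^sup>2 + \<beta> * l + \<gamma> \<le> \<alpha> * t\<^sup>2 + \<beta> * t + \<gamma>"
    and "\<alpha> * t\<^sup>2 + \<beta> * t + \<gamma> \<le> \<alpha> * r\<^sup>2 + \<beta> * r + \<gamma>"
proof -
  have s: "0 \<le> 2 * \<alpha> * t + \<beta>"
    using quad_slope_between[OF assms] .
  have "0 \<le> (t - l) * ((2 * \<alpha> * l + \<beta>) + (2 * \<alpha> * t + \<beta>))"
    using assms s by (intro mult_nonneg_nonneg) auto
  then show "\<alpha> * l\<^sup>2 + \<beta> * l + \<gamma> \<le> \<alpha> * t\<^sup>2 + \<beta> * t + \<gamma>"
    by (simp add: algebra_simps power2_eq_square)
  have "0 \<le> (r - t) * ((2 * \<alpha> * r + \<beta>) + (2 * \<alpha> * t + \<beta>))"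
    using assms s by (intro mult_nonneg_nonneg) auto
  then show "\<alpha> * t\<^sup>2 + \<beta> * t + \<gamma> \<le> \<alpha> * r\<^sup>2 + \<beta> * r + \<gamma>"
    by (simp add: algebra_simps power2_eq_square)
qed

text \<open>The secant from \<open>l\<close> to \<open>t\<close> has slope
  \<open>\<alpha> * (t + l) + \<beta>\<close>. If it is negative, concavity makes the slope of the
  secant from \<open>t\<close> to \<open>r\<close> nonpositive.\<close>

lemma quad_concave_ge_min:
  fixes \<alpha> \<beta> \<gamma> l r t :: real
  assumes "\<alpha> \<le> 0" "l \<le> t" "t \<le> r"
  shows "min (\<alpha> * l\<^sup>2 + \<beta> * l + \<gamma>) (\<alpha> * r\<^sup>2 + \<beta> * r + \<gamma>) \<le> \<alpha> * t\<^sup>2 + \<beta> * t + \<gamma>"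
proof (cases "0 \<le> \<alpha> * (t + l) + \<beta>")
  case True
  then have "0 \<le> (t - l) * (\<alpha> * (t + l) + \<beta>)" using assms by simp
  then have "\<alpha> * l\<^sup>2 + \<beta> * l + \<gamma> \<le> \<alpha> * t\<^sup>2 + \<beta> * t + \<gamma>"
    by (simp add: algebra_simps power2_eq_square)
  then show ?thesis by linarith
next
  case False
  have "\<alpha> * r \<le> \<alpha> * l" using assms by (simp add: mult_left_mono_neg)
  then have "\<alpha> * (t + r) + \<beta> \<le> 0" using False by (simp add: algebra_simps)
  then have "0 \<le> (t - r) * (\<alpha> * (t + r) + \<beta>)" using assms by (simp add: mult_nonpos_nonpos)
  then have "\<alpha> * r\<^sup>2 + \<beta> * r + \<gamma> \<le> \<alpha> * t\<^sup>2 + \<beta> * t + \<gamma>"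
    by (simp add: algebra_simps power2_eq_square)
  then show ?thesis by linarith
qed

lemma quad_convex_le_max:
  fixes \<alpha> \<beta> \<gamma> l r t :: real
  assumes "0 \<le> \<alpha>" "l \<le> t" "t \<le> r"
  shows "\<alpha> * t\<^sup>2 + \<beta> * t + \<gamma> \<le> max (\<alpha> * l\<^sup>2 + \<beta> * l + \<gamma>) (\<alpha> * r\<^sup>2 + \<beta> * r + \<gamma>)"
  using quad_concave_ge_min[of "-\<alpha>" l t r "-\<beta>" "-\<gamma>"] assms by (auto simp: min_def max_def split: if_splits)

lemma quad_le_vertex:
  fixes \<alpha> \<beta> \<gamma> t :: real
  assumes "\<alpha> < 0"
  shows "\<alpha> * t\<^sup>2 + \<beta> * t + \<gamma> \<le> \<gamma> - \<beta>\<^sup>2 / (4 * \<alpha>)"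
proof -
  have "\<alpha> * t\<^sup>2 + \<beta> * t + \<gamma> = \<gamma> - \<beta>\<^sup>2 / (4 * \<alpha>) + \<alpha> * (t + \<beta> / (2 * \<alpha>))\<^sup>2"
    using assms by (simp add: field_simps power2_eq_square)
  moreover have "\<alpha> * (t + \<beta> / (2 * \<alpha>))\<^sup>2 \<le> 0"
    using assms by (simp add: mult_nonpos_nonneg)
  ultimately show ?thesis by linarith
qed

section \<open>Bounds along the three edges\<close>

text \<open>This is the edge \<open>x = 1\<close>; exchanging \<open>a\<close> and \<open>c\<close>
  gives \<open>y = 1\<close>. If the end slopes \<open>b\<close> and
  \<open>b + 2 * \<tau> * c\<close> are nonnegative, the polynomial is monotone; otherwise it is
  concave, bounded above by its vertex value and below by its end values.\<close>

lemma axis_edge_bound: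
  assumes b: "0 \<le> b" and A: "\<bar>a\<bar> \<le> M" and B: "\<bar>a + \<tau> * b + \<tau>\<^sup>2 * c\<bar> \<le> M"
    and crit: "0 \<le> b + 2 * \<tau> * c \<or> a - b\<^sup>2 / (4 * c) \<le> M"
    and y: "0 \<le> y" "y \<le> \<tau>"
  shows "\<bar>a + b * y + c * y\<^sup>2\<bar> \<le> M"
proof (cases "0 \<le> b + 2 * \<tau> * c")
  case True
  then show ?thesis
    using quad_mono[of c 0 b \<tau> y a] assms by (simp add: algebra_simps abs_le_iff)
next
  case False
  then have "\<tau> * c < 0" using b by linarith
  then have c: "c < 0"
    using tau_gt by (simp add: mult_less_0_iff)
  have "c * y\<^sup>2 + b * y + a \<le> M"
    using quad_le_vertex[OF c, of y b a] crit False by linarith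
  moreover have "- M \<le> c * y\<^sup>2 + b * y + a"
    using quad_concave_ge_min[of c 0 y \<tau> b a] c y A B
    by (auto simp: algebra_simps abs_le_iff min_def split: if_splits)
  ultimately show ?thesis by (simp add: algebra_simps abs_le_iff)
qed

text \<open>The parameter \<open>s\<close> stands for \<open>(sqrt 2 * s, sqrt 2 * (1 - s))\<close>,
  with \<open>\<delta>\<close> and \<open>1 - \<delta>\<close> at the vertices
  \<open>(\<tau>, 1)\<close> and \<open>(1, \<tau>)\<close>. The first two alternatives of
  \<open>crit\<close> are a nonpositive slope at the left end and a nonnegative slope at the right
  end; if both fail, an interior maximum exists and the third bounds it.\<close>

lemma diagonal_edge_bound:
  assumes b: "0 \<le> b" and B: "\<bar>a + \<tau> * b + \<tau>\<^sup>2 * c\<bar> \<le> M" and C: "\<bar>\<tau>\<^sup>2 * a + \<tau> * b + c\<bar> \<le> M"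
    and crit: "\<delta> * b + \<tau> * a \<le> c \<or> \<delta> * b + \<tau> * c \<le> a \<or> (4 * a * c - b\<^sup>2) / (2 * (a - b + c)) \<le> M"
    and s: "\<delta> \<le> s" "s \<le> 1 - \<delta>"
  shows "\<bar>2 * (a * s\<^sup>2 + b * s * (1 - s) + c * (1 - s)\<^sup>2)\<bar> \<le> M"
proof -
  define \<alpha> \<beta> where "\<alpha> = a - b + c" and "\<beta> = b - 2 * c"
  define q where "q t = \<alpha> * t\<^sup>2 + \<beta> * t + c" for t
  have q: "2 * q t = 2 * (a * t\<^sup>2 + b * t * (1 - t) + c * (1 - t)\<^sup>2)" for t
    by (simp add: q_def \<alpha>_def \<beta>_def algebra_simps power2_eq_square)
  have ql: "2 * q \<delta> = \<tau>\<^sup>2 * a + \<tau> * b + c"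
    unfolding q \<delta>_def by (simp add: field_simps power2_eq_square tau_mult_tau)
  have qr: "2 * q (1 - \<delta>) = a + \<tau> * b + \<tau>\<^sup>2 * c"
    unfolding q \<delta>_def by (simp add: field_simps power2_eq_square tau_mult_tau)
  have sl: "2 * \<alpha> * \<delta> + \<beta> = (1 + \<tau>) * (\<delta> * b + \<tau> * a - c)"
    unfolding \<alpha>_def \<beta>_def \<delta>_def by (simp add: field_simps power2_eq_square tau_mult_tau)
  have sr: "2 * \<alpha> * (1 - \<delta>) + \<beta> = (1 + \<tau>) * (a - \<delta> * b - \<tau> * c)"
    unfolding \<alpha>_def \<beta>_def \<delta>_def by (simp add: field_simps power2_eq_square tau_mult_tau)
  \<comment> \<open>Up to positive factors this is the difference of the end slopes, so opposite
    slopes reveal the sign of \<open>\<alpha>\<close>.\<close>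
  have sum: "(1 - \<tau>) * \<alpha> = (a - \<delta> * b - \<tau> * c) - (\<delta> * b + \<tau> * a - c)"
    by (simp add: \<alpha>_def \<delta>_def field_simps)
  have tp: "0 < \<tau>" "0 < 1 + \<tau>" "0 < 1 - \<tau>" using tau_gt tau_lt by auto
  have dp: "0 < \<delta>" using tp by (simp add: \<delta>_def)
  have "\<bar>2 * q s\<bar> \<le> M"
  proof (cases "c \<le> \<delta> * b + \<tau> * a")
    case l: True
    show ?thesis
    proof (cases "\<delta> * b + \<tau> * c \<le> a")
      case True
      then have "0 \<le> 2 * \<alpha> * \<delta> + \<beta>" "0 \<le> 2 * \<alpha> * (1 - \<delta>) + \<beta>"
        unfolding sl sr using l tp by simp_all
      from quad_mono[OF this s, of c, folded q_def] B C ql qr show ?thesis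
        by linarith
    next
      case r: False
      show ?thesis
      \<comment> \<open>Equality satisfies the first alternative of \<open>crit\<close>, which then
        says nothing about the vertex value; but the left slope is zero and the right one negative,
        so \<open>q\<close> decreases.\<close>
      proof (cases "c = \<delta> * b + \<tau> * a")
        case True
        have "0 \<le> - (2 * \<alpha> * \<delta> + \<beta>)" "0 \<le> - (2 * \<alpha> * (1 - \<delta>) + \<beta>)"
          unfolding sl sr using True r tp by (auto simp: mult_le_0_iff)
        then have "q (1 - \<delta>) \<le> q s" "q s \<le> q \<delta>"
          using quad_mono[of "-\<alpha>" \<delta> "-\<beta>" "1 - \<delta>" s "-c"] s by (simp_all add: q_def)
        then show ?thesis using B C ql qr by linarith
      next
        case False
        have "(1 - \<tau>) * \<alpha> < 0" using sum l r by linarith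
        then have \<alpha>: "\<alpha> < 0" using tp by (simp add: mult_less_0_iff)
        have vertex: "(4 * a * c - b\<^sup>2) / (2 * \<alpha>) = 2 * (c - \<beta>\<^sup>2 / (4 * \<alpha>))"
        proof -
          have "4 * a * c - b\<^sup>2 = 4 * c * \<alpha> - \<beta>\<^sup>2"
            by (simp add: \<alpha>_def \<beta>_def algebra_simps power2_eq_square)
          then show ?thesis using \<alpha> by (simp add: diff_divide_distrib)
        qed
        have "2 * q s \<le> 2 * (c - \<beta>\<^sup>2 / (4 * \<alpha>))"
          using quad_le_vertex[OF \<alpha>, of s \<beta> c, folded q_def] by (rule mult_left_mono) simp
        also have "\<dots> \<le> M"
          unfolding vertex[symmetric] using crit l r False by (auto simp: \<alpha>_def)
        finally have "2 * q s \<le> M" .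
        moreover have "- M \<le> 2 * q s"
          using quad_concave_ge_min[of \<alpha>, OF _ s, of \<beta> c, folded q_def] \<alpha> B C ql qr by linarith
        ultimately show ?thesis by linarith
      qed
    qed
  next
    case l: False
    show ?thesis
    proof (cases "a \<le> \<delta> * b + \<tau> * c")
      case True
      have "0 \<le> - (2 * \<alpha> * \<delta> + \<beta>)" "0 \<le> - (2 * \<alpha> * (1 - \<delta>) + \<beta>)"
        unfolding sl sr using True l tp by (auto simp: mult_le_0_iff)
      then have "q (1 - \<delta>) \<le> q s" "q s \<le> q \<delta>"
        using quad_mono[of "-\<alpha>" \<delta> "-\<beta>" "1 - \<delta>" s "-c"] s by (simp_all add: q_def)
      then show ?thesis using B C ql qr by linarith
    next
      case r: False
      have "0 < (1 - \<tau>) * \<alpha>" using sum l r by linarith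
      then have \<alpha>: "0 < \<alpha>" using tp by (simp add: zero_less_mult_iff)
      have db: "0 \<le> \<delta> * b" using dp b by simp
      \<comment> \<open>The edge is convex with an interior minimum, which must be bounded below.
        The failed slope conditions force \<open>a\<close> and \<open>c\<close> to be nonnegative,
        so the form is nonnegative there.\<close>
      have "0 \<le> a"
      proof (rule ccontr)
        assume "\<not> 0 \<le> a"
        then have "c > 0" using \<alpha> b by (simp add: \<alpha>_def)
        then have "0 < \<tau> * c" using tp by simp
        then show False using r db \<open>\<not> 0 \<le> a\<close> by linarith
      qed
      have "0 \<le> c"
      proof -
        have "0 \<le> \<tau> * a" using tp \<open>0 \<le> a\<close> by simp
        then show ?thesis using l db by linarith
      qed
      have "0 \<le> s" "0 \<le> 1 - s" using s dp by auto
      then have "0 \<le> 2 * q s"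
        unfolding q using \<open>0 \<le> a\<close> \<open>0 \<le> c\<close> b by simp
      moreover have "2 * q s \<le> M"
        using quad_convex_le_max[of \<alpha>, OF _ s, of \<beta> c, folded q_def] \<alpha> B C ql qr by linarith
      ultimately show ?thesis by linarith
    qed
  qed
  then show ?thesis by (simp only: q)
qed

section \<open>From the edges to the whole octagon\<close>

text \<open>Segments from the origin to the three edges fill the octagon. Shrinking an edge point by
  a factor in \<open>[0, 1]\<close> multiplies the form by the square of that factor, here
  \<open>x\<close>, \<open>y\<close> or \<open>(x + y) / sqrt 2\<close>.\<close>

lemma octagon_bound_if_edge_bounds:
  assumes x1: "\<And>y. 0 \<le> y \<Longrightarrow> y \<le> \<tau> \<Longrightarrow> \<bar>a + b * y + c * y\<^sup>2\<bar> \<le> M"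
    and y1: "\<And>x. 0 \<le> x \<Longrightarrow> x \<le> \<tau> \<Longrightarrow> \<bar>c + b * x + a * x\<^sup>2\<bar> \<le> M"
    and diag: "\<And>s. \<delta> \<le> s \<Longrightarrow> s \<le> 1 - \<delta> \<Longrightarrow> \<bar>2 * (a * s\<^sup>2 + b * s * (1 - s) + c * (1 - s)\<^sup>2)\<bar> \<le> M"
    and p: "p \<in> octagon"
  shows "\<bar>qform a b c p\<bar> \<le> M"
proof -
  have M: "0 \<le> M" using x1[of 0] tau_gt by linarith
  have scale: "\<bar>k * v\<bar> \<le> M" if "0 \<le> k" "k \<le> 1" "\<bar>v\<bar> \<le> M" for k v :: real
    using that mult_mono[of k 1 "\<bar>v\<bar>" M] by (simp add: abs_mult)
  obtain x y where p_eq: "p = (x, y)" by (cases p)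
  have xy: "0 \<le> x" "x \<le> 1" "0 \<le> y" "y \<le> 1" "x + y \<le> sqrt 2"
    using p by (auto simp: octagon_def p_eq)
  have "x = 0 \<and> y = 0 \<or> 0 < x" if "y \<le> \<tau> * x"
    using that xy by (cases "x = 0") auto
  moreover have "x = 0 \<and> y = 0 \<or> 0 < y" if "x \<le> \<tau> * y"
    using that xy by (cases "y = 0") auto
  moreover have "x = 0 \<and> y = 0 \<or> 0 < x + y"
    using xy by linarith
  ultimately consider "x = 0 \<and> y = 0" | "0 < x" "y \<le> \<tau> * x" | "0 < y" "x \<le> \<tau> * y"
    | "0 < x + y" "\<tau> * x \<le> y" "\<tau> * y \<le> x"
    by (meson linear)
  then show ?thesis
  proof cases
    case 1
    then show ?thesis using M by (simp add: p_eq qform_def)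
  next
    case 2
    have "qform a b c p = x\<^sup>2 * (a + b * (y / x) + c * (y / x)\<^sup>2)"
      using 2 by (simp add: p_eq qform_def field_simps power2_eq_square)
    then show ?thesis
      using scale[of "x\<^sup>2", OF _ _ x1[of "y / x"]] 2 xy by (simp add: divide_le_eq power_le_one)
  next
    case 3
    have "qform a b c p = y\<^sup>2 * (c + b * (x / y) + a * (x / y)\<^sup>2)"
      using 3 by (simp add: p_eq qform_def field_simps power2_eq_square)
    then show ?thesis
      using scale[of "y\<^sup>2", OF _ _ y1[of "x / y"]] 3 xy by (simp add: divide_le_eq power_le_one)
  next
    case 4
    define w where "w = x + y"
    define s where "s = x / w"
    have w: "0 < w" using 4 by (simp add: w_def)
    have x: "x = w * s" and y: "y = w * (1 - s)"
      using w by (auto simp: s_def w_def field_simps)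
    have eq: "qform a b c p = (w\<^sup>2 / 2) * (2 * (a * s\<^sup>2 + b * s * (1 - s) + c * (1 - s)\<^sup>2))"
      by (simp add: p_eq qform_def x y algebra_simps power2_eq_square)
    have tp: "0 < 1 + \<tau>" using tau_gt by simp
    have d: "\<delta> * (1 + \<tau>) = \<tau>"
      by (simp add: \<delta>_def field_simps tau_mult_tau)
    have "w * (\<tau> * s) \<le> w * (1 - s)" "w * (\<tau> * (1 - s)) \<le> w * s"
      using 4 by (simp_all add: x y algebra_simps)
    then have "\<tau> * s \<le> 1 - s" "\<tau> * (1 - s) \<le> s"
      using w by simp_all
    then have "\<delta> * (1 + \<tau>) \<le> s * (1 + \<tau>)" "s * (1 + \<tau>) \<le> (1 - \<delta>) * (1 + \<tau>)"
      using d by (simp_all add: algebra_simps)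
    then have s: "\<delta> \<le> s" "s \<le> 1 - \<delta>"
      using tp by simp_all
    have "w\<^sup>2 \<le> (sqrt 2)\<^sup>2"
      using w xy by (intro power_mono) (auto simp: w_def)
    then show ?thesis
      using scale[of "w\<^sup>2 / 2", OF _ _ diag[OF s]] by (simp only: eq) simp
  qed
qed

text \<open>The upper bound behind every case: four vertex values and, for the edges
  \<open>y = 1\<close>, \<open>x = 1\<close> and the diagonal in this order, either a slope
  excluding an interior maximum or a bound on the critical value.\<close>

lemma octagon_qform_bound:
  assumes b: "0 \<le> b" and "\<bar>a\<bar> \<le> M" "\<bar>c\<bar> \<le> M"
    and "\<bar>a + \<tau> * b + \<tau>\<^sup>2 * c\<bar> \<le> M" "\<bar>\<tau>\<^sup>2 * a + \<tau> * b + c\<bar> \<le> M"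
    and "0 \<le> b + 2 * \<tau> * a \<or> c - b\<^sup>2 / (4 * a) \<le> M"
    and "0 \<le> b + 2 * \<tau> * c \<or> a - b\<^sup>2 / (4 * c) \<le> M"
    and "\<delta> * b + \<tau> * a \<le> c \<or> \<delta> * b + \<tau> * c \<le> a \<or> (4 * a * c - b\<^sup>2) / (2 * (a - b + c)) \<le> M"
    and "p \<in> octagon"
  shows "\<bar>qform a b c p\<bar> \<le> M"
proof (rule octagon_bound_if_edge_bounds[OF _ _ _ \<open>p \<in> octagon\<close>])
  show "\<bar>a + b * y + c * y\<^sup>2\<bar> \<le> M" if "0 \<le> y" "y \<le> \<tau>" for y
    using axis_edge_bound[of b a M c y] assms that by blast
  have "\<bar>c + \<tau> * b + \<tau>\<^sup>2 * a\<bar> \<le> M"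
    using assms by (simp add: algebra_simps)
  then show "\<bar>c + b * x + a * x\<^sup>2\<bar> \<le> M" if "0 \<le> x" "x \<le> \<tau>" for x
    using axis_edge_bound[of b c M a x] assms that by blast
  show "\<bar>2 * (a * s\<^sup>2 + b * s * (1 - s) + c * (1 - s)\<^sup>2)\<bar> \<le> M" if "\<delta> \<le> s" "s \<le> 1 - \<delta>" for s
    using diagonal_edge_bound[of b a c M s] assms that by blast
qed

section \<open>The norm as an attained maximum, its symmetry and scaling\<close>

lemma oct_norm_eqI:
  assumes "p \<in> octagon" "\<bar>qform a b c p\<bar> = K" "\<And>q. q \<in> octagon \<Longrightarrow> \<bar>qform a b c q\<bar> \<le> K"
  shows "oct_norm a b c = K"
  unfolding oct_norm_def using assms by (intro cSup_eq_maximum) auto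

lemma vertices_in_octagon:
  "(1, 0) \<in> octagon" "(0, 1) \<in> octagon" "(1, \<tau>) \<in> octagon" "(\<tau>, 1) \<in> octagon"
  using tau_gt tau_lt by (auto simp: octagon_def sqrt2_eq)

text \<open>\<open>M\<close> is one of the four vertex values, so it is attained, and it is an upper
  bound once no interior maximum exceeds it.\<close>

lemma oct_norm_eq_vertex_max:
  assumes b: "0 \<le> b"
    and M: "M = max (max \<bar>a\<bar> \<bar>c\<bar>) (max \<bar>a + \<tau> * b + \<tau>\<^sup>2 * c\<bar> \<bar>\<tau>\<^sup>2 * a + \<tau> * b + c\<bar>)"
    and "0 \<le> b + 2 * \<tau> * a \<or> c - b\<^sup>2 / (4 * a) \<le> M"
    and "0 \<le> b + 2 * \<tau> * c \<or> a - b\<^sup>2 / (4 * c) \<le> M"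
    and "\<delta> * b + \<tau> * a \<le> c \<or> \<delta> * b + \<tau> * c \<le> a \<or> (4 * a * c - b\<^sup>2) / (2 * (a - b + c)) \<le> M"
  shows "oct_norm a b c = M"
proof -
  have "\<bar>a\<bar> \<le> M" "\<bar>c\<bar> \<le> M" "\<bar>a + \<tau> * b + \<tau>\<^sup>2 * c\<bar> \<le> M" "\<bar>\<tau>\<^sup>2 * a + \<tau> * b + c\<bar> \<le> M"
    by (simp_all add: M le_max_iff_disj)
  then have bd: "\<bar>qform a b c q\<bar> \<le> M" if "q \<in> octagon" for q
    using octagon_qform_bound[OF b _ _ _ _ assms(3-5) that] by blast
  consider "M = \<bar>a\<bar>" | "M = \<bar>c\<bar>" | "M = \<bar>a + \<tau> * b + \<tau>\<^sup>2 * c\<bar>" | "M = \<bar>\<tau>\<^sup>2 * a + \<tau> * b + c\<bar>"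
    using M by (metis max_def)
  then show ?thesis
  proof cases
    case 1
    then show ?thesis
      by (intro oct_norm_eqI[OF vertices_in_octagon(1) _ bd]) (simp_all add: qform_def)
  next
    case 2
    then show ?thesis
      by (intro oct_norm_eqI[OF vertices_in_octagon(2) _ bd]) (simp_all add: qform_def)
  next
    case 3
    then show ?thesis
      by (intro oct_norm_eqI[OF vertices_in_octagon(3) _ bd]) (simp_all add: qform_def mult.commute)
  next
    case 4
    then show ?thesis
      by (intro oct_norm_eqI[OF vertices_in_octagon(4) _ bd]) (simp_all add: qform_def mult.commute)
  qed
qed

text \<open>Reflection in the line \<open>x = y\<close> preserves the octagon; this carries
  \<open>\<I>1\<close> over to \<open>\<I>3\<close>.\<close>

lemma oct_norm_swap: "oct_norm a b c = oct_norm c b a"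
proof -
  have "prod.swap ` octagon = octagon"
    by (force simp: octagon_def image_iff)
  then have "oct_norm a b c = (SUP p\<in>prod.swap ` octagon. \<bar>qform a b c p\<bar>)"
    by (simp add: oct_norm_def)
  also have "\<dots> = oct_norm c b a"
    unfolding oct_norm_def image_image
    by (intro arg_cong[where f = Sup] image_cong) (auto simp: qform_def algebra_simps)
  finally show ?thesis .
qed

text \<open>Homogeneity normalises the middle coefficient to 1 whatever the sign of
  \<open>b\<close>, so estimates assuming \<open>0 \<le> b\<close> suffice.\<close>

lemma oct_norm_scale:
  assumes "b \<noteq> 0" and K: "oct_norm (a / b) 1 (c / b) = K"
  shows "oct_norm a b c = \<bar>b\<bar> * K"
proof -
  have q: "qform a b c p = b * qform (a / b) 1 (c / b) p" for p
    using assms by (cases p) (simp add: qform_def field_simps)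
  \<comment> \<open>Boundedness, from compactness, lets multiplication by
    \<open>\<bar>b\<bar>\<close> commute with \<open>Sup\<close>.\<close>
  have bdd: "bdd_above ((\<lambda>p. \<bar>qform (a / b) 1 (c / b) p\<bar>) ` octagon)"
  proof (intro bounded_imp_bdd_above compact_imp_bounded compact_continuous_image)
    have "octagon = ({0..1} \<times> {0..1}) \<inter> {p. fst p + snd p \<le> sqrt 2}"
      by (auto simp: octagon_def)
    moreover have "compact (({0..1::real} \<times> {0..1::real}) \<inter> {p. fst p + snd p \<le> sqrt 2})"
      by (intro compact_Int_closed compact_Times compact_Icc closed_Collect_le continuous_intros)
    ultimately show "compact octagon" by simp
  qed (use assms(1) in \<open>auto simp: qform_def case_prod_unfold intro!: continuous_intros\<close>)
  have "oct_norm a b c = (SUP p\<in>octagon. \<bar>b\<bar> * \<bar>qform (a / b) 1 (c / b) p\<bar>)"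
    unfolding oct_norm_def q abs_mult ..
  also have "\<dots> = \<bar>b\<bar> * oct_norm (a / b) 1 (c / b)"
  proof -
    have "Sup ((\<lambda>x. \<bar>b\<bar> * x) ` (\<lambda>p. \<bar>qform (a / b) 1 (c / b) p\<bar>) ` octagon)
        = \<bar>b\<bar> * Sup ((\<lambda>p. \<bar>qform (a / b) 1 (c / b) p\<bar>) ` octagon)"
      using vertices_in_octagon bdd
      by (intro continuous_at_Sup_mono[symmetric] monoI continuous_intros mult_left_mono) auto
    then show ?thesis by (simp add: oct_norm_def image_image)
  qed
  finally show ?thesis using K by simp
qed

section \<open>Regions with an interior maximum on an edge\<close>

text \<open>\<open>u \<le> - \<eta>\<close> puts the critical point \<open>- 1 / (2 * u)\<close> on
  the edge \<open>y = 1\<close>, and the condition on \<open>v\<close> says that the critical value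
  is at least \<open>- u\<close>. Then \<open>v > 3 / 4\<close> and \<open>u < - 1\<close> exclude
  interior maxima on the other edges.\<close>

lemma oct_norm_I1:
  assumes "(u, v) \<in> \<I>1"
  shows "oct_norm u 1 v = v - 1 / (4 * u)"
proof -
  define K where "K = v - 1 / (4 * u)"
  have u: "u \<le> - \<eta>" and v: "- u + 1 / (4 * u) \<le> v"
    using assms by (auto simp: \<I>1_def)
  have u1: "u \<le> - 1 - \<tau> / 2" using u by (simp add: eta_eq)
  have u0: "u < - 1" using u1 tau_gt by linarith
  have inv: "- (1 / 4) < 1 / (4 * u)" "1 / (4 * u) < 0" using u0 by (auto simp: field_simps)
  have v0: "3 / 4 < v" using v inv u0 by linarith
  have K: "- u \<le> K" "v \<le> K" using v inv by (auto simp: K_def)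
  have tp: "0 < \<tau>" "0 < \<tau>\<^sup>2" using tau_gt by auto
  \<comment> \<open>The vertex \<open>(\<tau>, 1)\<close> lies on the edge \<open>y = 1\<close>, so
    its value cannot exceed the critical value.\<close>
  have C: "\<tau>\<^sup>2 * u + \<tau> + v \<le> K"
    using quad_le_vertex[of u \<tau> 1 v] u0 by (simp add: K_def algebra_simps)
  have "\<tau>\<^sup>2 * v \<ge> 0" using tp v0 by simp
  then have B: "u \<le> u + \<tau> + \<tau>\<^sup>2 * v" using tp by linarith
  have BC: "u + \<tau> + \<tau>\<^sup>2 * v \<le> \<tau>\<^sup>2 * u + \<tau> + v"
  proof -
    have "\<tau>\<^sup>2 \<le> 1" using tau_sq tau_gt by simp
    then have "(1 - \<tau>\<^sup>2) * (u - v) \<le> 0" using u0 v0 by (simp add: mult_nonneg_nonpos)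
    then show ?thesis by (simp add: algebra_simps)
  qed
  have diag: "\<delta> * 1 + \<tau> * u \<le> v"
  proof -
    have "\<tau> * u \<le> 0" using tp u0 by (simp add: mult_le_0_iff)
    moreover have "\<delta> < 1 / 2" using tp by (simp add: \<delta>_def)
    ultimately show ?thesis using v0 by linarith
  qed
  have bd: "\<bar>qform u 1 v q\<bar> \<le> K" if "q \<in> octagon" for q
  proof (rule octagon_qform_bound[OF _ _ _ _ _ _ _ _ that])
    show "0 \<le> 1 + 2 * \<tau> * v \<or> u - 1\<^sup>2 / (4 * v) \<le> K"
      using v0 tp by simp
  qed (use K C B BC u0 v0 diag in \<open>auto simp: K_def abs_le_iff\<close>)
  have x: "0 < - 1 / (2 * u)" "- 1 / (2 * u) \<le> \<tau>"
  proof -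
    show "0 < - 1 / (2 * u)" using u0 by (simp add: field_simps)
    have "\<tau> * u \<le> \<tau> * - \<eta>" using u tp by (intro mult_left_mono) auto
    then show "- 1 / (2 * u) \<le> \<tau>" using eta_tau u0 by (simp add: field_simps)
  qed
  have "oct_norm u 1 v = K"
  proof (rule oct_norm_eqI[OF _ _ bd])
    show "(- 1 / (2 * u), 1) \<in> octagon"
      using x tau_lt by (auto simp: octagon_def sqrt2_eq)
    have "qform u 1 v (- 1 / (2 * u), 1) = K"
      using u0 by (simp add: qform_def K_def field_simps power2_eq_square)
    then show "\<bar>qform u 1 v (- 1 / (2 * u), 1)\<bar> = K"
      using K u0 by simp
  qed
  then show ?thesis by (simp add: K_def)
qed

text \<open>Below \<open>- \<eta>\<close> the linear constraint makes \<open>v\<close> negative;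
  then \<open>u * v\<close> is nonnegative and \<open>- 2 * u\<close> exceeds 2, against the
  quadratic one. The bound keeps axis-parallel edges free of interior maxima on
  \<open>\<I>2\<close>.\<close>

lemma I2_ge:
  assumes "v \<le> \<delta> + \<tau> * u" "2 * u\<^sup>2 + 6 * u * v - 2 * u - 1 \<le> 0"
  shows "- \<eta> \<le> u"
proof (rule ccontr)
  assume "\<not> - \<eta> \<le> u"
  then have u: "u < - \<eta>" by simp
  then have "\<tau> * u < \<tau> * - \<eta>" using tau_gt by (intro mult_strict_left_mono) auto
  moreover have "\<delta> < 1 / 2" using tau_gt by (simp add: \<delta>_def)
  ultimately have "v < 0" using assms(1) eta_tau by linarith
  moreover have "u < - 1" using u eta_eq tau_gt by linarith
  ultimately have "0 \<le> u * v" "0 \<le> u\<^sup>2" by (simp_all add: mult_nonpos_nonpos)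
  then show False using assms(2) \<open>u < - 1\<close> by linarith
qed

text \<open>The linear constraints place the critical point on the diagonal edge. Clearing the
  negative denominator \<open>2 * (u - 1 + v)\<close> shows that the quadratic ones mean
  \<open>- u \<le> K\<close> and \<open>- v \<le> K\<close> for the critical value
  \<open>K\<close>.\<close>

lemma oct_norm_I2:
  assumes "(u, v) \<in> \<I>2"
  shows "oct_norm u 1 v = \<Xi>2 u 1 v"
proof -
  have l: "v \<le> \<delta> + \<tau> * u" and r: "u \<le> \<delta> + \<tau> * v"
    and qu: "2 * u\<^sup>2 + 6 * u * v - 2 * u - 1 \<le> 0" and qv: "2 * v\<^sup>2 + 6 * v * u - 2 * v - 1 \<le> 0"
    using assms by (auto simp: \<I>2_def algebra_simps)
  have tp: "0 < \<tau>" "\<tau> < 1" using tau_gt tau_lt by auto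
  have u: "- \<eta> \<le> u" using I2_ge[OF l qu] .
  have v: "- \<eta> \<le> v" using I2_ge[OF r qv] .
  have slope: "0 \<le> 1 + 2 * \<tau> * t" if "- \<eta> \<le> t" for t
    using mult_left_mono[OF that, of "2 * \<tau>"] eta_tau tp by simp
  \<comment> \<open>Values increase along the axis-parallel edges, so the vertices
    \<open>(1, \<tau>)\<close> and \<open>(\<tau>, 1)\<close> inherit lower bounds from
    \<open>u\<close> and \<open>v\<close>.\<close>
  have AB: "t \<le> t + \<tau> + \<tau>\<^sup>2 * w" if "- \<eta> \<le> w" for t w
  proof -
    have "0 \<le> \<tau> * (1 + 2 * \<tau> * w) + \<tau>"
      using slope[OF that] tp by (simp add: add_nonneg_nonneg)
    then show ?thesis by (simp add: algebra_simps power2_eq_square)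
  qed
  show ?thesis
  \<comment> \<open>Here the form is half the square of \<open>x + y\<close>, constant on the
    diagonal edge; the critical quotient is \<open>0 / 0\<close>, and the vertices supply the value
    1.\<close>
  proof (cases "u = 1 / 2 \<and> v = 1 / 2")
    case True
    have "oct_norm u 1 v = max (max \<bar>u\<bar> \<bar>v\<bar>) (max \<bar>u + \<tau> * 1 + \<tau>\<^sup>2 * v\<bar> \<bar>\<tau>\<^sup>2 * u + \<tau> * 1 + v\<bar>)"
    proof (rule oct_norm_eq_vertex_max[OF _ refl])
      show "0 \<le> 1 + 2 * \<tau> * u \<or> v - 1\<^sup>2 / (4 * u) \<le> M" "0 \<le> 1 + 2 * \<tau> * v \<or> u - 1\<^sup>2 / (4 * v) \<le> M"
        for M using True tp by simp_all
      show "\<delta> * 1 + \<tau> * u \<le> v \<or> P" for P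
        using True by (simp add: \<delta>_def field_simps)
    qed simp
    moreover have uv: "u = 1 / 2" "v = 1 / 2" using True by auto
    ultimately show ?thesis unfolding uv by (simp add: \<Xi>2_def tau_sq field_simps)
  next
    case False
    define K where "K = (4 * u * v - 1) / (2 * (u - 1 + v))"
    have sum: "(1 - \<tau>) * (u - 1 + v) = (u - \<delta> - \<tau> * v) + (v - \<delta> - \<tau> * u)"
      by (simp add: \<delta>_def field_simps)
    \<comment> \<open>If this vanished, both linear constraints would be equalities, and these meet
      only at \<open>u = v = 1 / 2\<close>.\<close>
    have "u - 1 + v \<noteq> 0"
    proof
      assume 0: "u - 1 + v = 0"
      then have "u = \<delta> + \<tau> * v" using sum l r by simp
      moreover have "v = 1 - u" using 0 by simp
      ultimately have "(1 + \<tau>) * (2 * u - 1) = 0" by (simp add: \<delta>_def field_simps)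
      then show False using False 0 tp by simp
    qed
    moreover have "(1 - \<tau>) * (u - 1 + v) \<le> 0" using sum l r by linarith
    ultimately have neg: "u - 1 + v < 0"
      using tp by (simp add: mult_le_0_iff)
    have Ku: "- u \<le> K" and Kv: "- v \<le> K"
      using qu qv neg by (simp_all add: K_def field_simps power2_eq_square)
    define s where "s = (2 * v - 1) / (2 * (u - 1 + v))"
    have s: "2 * (u - 1 + v) * s = 2 * v - 1" using neg by (simp add: s_def)
    have "\<delta> \<le> s"
    proof -
      have "0 \<le> (1 + \<tau>) * (\<delta> + \<tau> * u - v)" using l tp by simp
      then have "2 * v - 1 \<le> 2 * (u - 1 + v) * \<delta>"
        by (simp add: \<delta>_def field_simps tau_mult_tau)
      then show ?thesis using neg by (simp add: s_def field_simps)
    qed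
    moreover have "s \<le> 1 - \<delta>"
    proof -
      have "0 \<le> (1 + \<tau>) * (\<delta> + \<tau> * v - u)" using r tp by simp
      then have "2 * (u - 1 + v) * (1 - \<delta>) \<le> 2 * v - 1"
        by (simp add: \<delta>_def field_simps tau_mult_tau)
      then show ?thesis using neg by (simp add: s_def field_simps)
    qed
    ultimately have "sqrt 2 * \<delta> \<le> sqrt 2 * s" "sqrt 2 * s \<le> sqrt 2 * (1 - \<delta>)"
      by (auto intro!: mult_left_mono)
    moreover have "sqrt 2 * \<delta> = \<tau>"
      unfolding sqrt2_eq \<delta>_def by (simp add: field_simps tau_mult_tau)
    moreover from this have "sqrt 2 * (1 - \<delta>) = 1"
      by (simp only: right_diff_distrib) (simp add: \<tau>_def)
    ultimately have x: "\<tau> \<le> sqrt 2 * s" "sqrt 2 * s \<le> 1"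
      by simp_all
    have p: "(sqrt 2 * s, sqrt 2 * (1 - s)) \<in> octagon"
      using x tp by (auto simp: octagon_def algebra_simps sqrt2_eq)
    have q: "qform u 1 v (sqrt 2 * t, sqrt 2 * (1 - t)) = 2 * ((u - 1 + v) * t\<^sup>2 + (1 - 2 * v) * t + v)" for t
      by (simp add: qform_def power_mult_distrib algebra_simps power2_eq_square)
    have vert: "K = 2 * (v - (1 - 2 * v)\<^sup>2 / (4 * (u - 1 + v)))"
      using neg by (simp add: K_def field_simps power2_eq_square)
    have qs: "qform u 1 v (sqrt 2 * s, sqrt 2 * (1 - s)) = K"
    proof -
      have "(u - 1 + v) * s\<^sup>2 = (2 * (u - 1 + v) * s) * s / 2"
        by (simp add: power2_eq_square)
      also have "\<dots> = (2 * v - 1) * s / 2"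
        unfolding s ..
      finally have "(u - 1 + v) * s\<^sup>2 = (2 * v - 1) * s / 2" .
      then have "qform u 1 v (sqrt 2 * s, sqrt 2 * (1 - s)) = (1 - 2 * v) * s + 2 * v"
        unfolding q by (simp add: algebra_simps)
      also have "\<dots> = K"
        unfolding vert using neg by (simp add: s_def field_simps power2_eq_square)
      finally show ?thesis .
    qed
    have le: "qform u 1 v (sqrt 2 * t, sqrt 2 * (1 - t)) \<le> K" for t
      unfolding q vert using quad_le_vertex[OF neg, of t "1 - 2 * v" v] by simp
    \<comment> \<open>The parameters are \<open>1 - \<delta>\<close> and, next,
      \<open>\<delta>\<close>, written out: the two ends of the diagonal edge.\<close>
    have B: "u + \<tau> + \<tau>\<^sup>2 * v \<le> K"
      using le[of "sqrt 2 / 2"] by (simp add: qform_def \<tau>_def algebra_simps)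
    have C: "\<tau>\<^sup>2 * u + \<tau> + v \<le> K"
      using le[of "1 - sqrt 2 / 2"] by (simp add: qform_def \<tau>_def algebra_simps)
    have AB': "u \<le> u + \<tau> + \<tau>\<^sup>2 * v" "v \<le> v + \<tau> + \<tau>\<^sup>2 * u" using AB u v by blast+
    have bd: "\<bar>qform u 1 v p\<bar> \<le> K" if "p \<in> octagon" for p
      by (rule octagon_qform_bound[OF _ _ _ _ _ _ _ _ that])
        (use Ku Kv B C AB' slope[OF u] slope[OF v] in \<open>auto simp: abs_le_iff K_def\<close>)
    have "0 \<le> K" using bd[OF p] by linarith
    then have "oct_norm u 1 v = K"
      using qs by (intro oct_norm_eqI[OF p _ bd]) auto
    then show ?thesis using False by (auto simp: \<Xi>2_def K_def)
  qed
qed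

lemma oct_norm_I3:
  assumes "(u, v) \<in> \<I>3"
  shows "oct_norm u 1 v = u - 1 / (4 * v)"
  using oct_norm_I1[of v u] oct_norm_swap[of u 1 v] assms by (simp add: \<I>1_def \<I>3_def)

section \<open>Interior points and the complementary region \<open>\<E>0\<close>\<close>

lemma interior_I1I:
  assumes "u < - \<eta>" "- u + 1 / (4 * u) < v"
  shows "(u, v) \<in> interior \<I>1"
proof (rule interiorI)
  text \<open>The condition on \<open>v\<close> is multiplied by \<open>4 u < 0\<close>, which makes it continuous everywhere.\<close>
  let ?S = "{p :: real \<times> real. fst p < - \<eta>} \<inter> {p. 4 * fst p * snd p < 1 - 4 * (fst p)\<^sup>2}"
  have e: "0 < \<eta>" using eta_eq tau_gt by simp
  have iff: "4 * x * y < 1 - 4 * x\<^sup>2 \<longleftrightarrow> - x + 1 / (4 * x) < y" if "x < - \<eta>" for x y :: real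
  proof -
    have "x < 0" using that e by linarith
    then show ?thesis by (simp add: field_simps power2_eq_square)
  qed
  show "open ?S"
    by (intro open_Int open_Collect_less continuous_intros)
  show "(u, v) \<in> ?S" using assms iff by simp
  show "?S \<subseteq> \<I>1" using iff by (force simp: \<I>1_def)
qed

lemma interior_I2I:
  assumes "v < \<delta> + \<tau> * u" "u < \<delta> + \<tau> * v"
    "2 * u\<^sup>2 + 6 * u * v - 2 * u - 1 < 0" "2 * v\<^sup>2 + 6 * u * v - 2 * v - 1 < 0"
  shows "(u, v) \<in> interior \<I>2"
proof (rule interiorI)
  let ?S = "{p :: real \<times> real. snd p < \<delta> + \<tau> * fst p} \<inter> {p. fst p < \<delta> + \<tau> * snd p}
    \<inter> {p. 2 * (fst p)\<^sup>2 + 6 * fst p * snd p - 2 * fst p - 1 < 0}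
    \<inter> {p. 2 * (snd p)\<^sup>2 + 6 * fst p * snd p - 2 * snd p - 1 < 0}"
  show "open ?S"
    by (intro open_Int open_Collect_less continuous_intros)
  show "(u, v) \<in> ?S" using assms by simp
  show "?S \<subseteq> \<I>2" by (auto simp: \<I>2_def)
qed

lemma interior_I3I:
  assumes "v < - \<eta>" "- v + 1 / (4 * v) < u"
  shows "(u, v) \<in> interior \<I>3"
proof (rule interiorI)
  let ?S = "prod.swap -` interior \<I>1"
  show "open ?S"
    by (intro open_vimage open_interior) (simp add: prod.swap_def continuous_intros)
  show "(u, v) \<in> ?S" using interior_I1I[OF assms] by simp
  show "?S \<subseteq> \<I>3" using interior_subset[of \<I>1] by (force simp: \<I>1_def \<I>3_def)
qed

text \<open>Outside the interiors, each region has a strict inequality that fails. Either an end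
  slope then excludes an interior maximum, or the critical value is at most \<open>- u\<close> or
  \<open>- v\<close>, hence at most \<open>M\<close>. Only vertex values remain, grouped by
  \<open>\<Phi>1\<close> and \<open>\<Phi>3\<close>.\<close>

lemma oct_norm_E0:
  assumes "(u, v) \<in> \<E>0"
  shows "oct_norm u 1 v = max (\<Phi>1 u v) (\<Phi>3 u v)"
proof -
  define M where "M = max (max \<bar>u\<bar> \<bar>v\<bar>) (max \<bar>u + \<tau> * 1 + \<tau>\<^sup>2 * v\<bar> \<bar>\<tau>\<^sup>2 * u + \<tau> * 1 + v\<bar>)"
  have M: "\<bar>u\<bar> \<le> M" "\<bar>v\<bar> \<le> M" by (simp_all add: M_def le_max_iff_disj)
  have n: "(u, v) \<notin> interior \<I>1" "(u, v) \<notin> interior \<I>2" "(u, v) \<notin> interior \<I>3"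
    using assms by (auto simp: \<E>0_def)
  have slope: "0 \<le> 1 + 2 * \<tau> * t" if "- \<eta> \<le> t" for t
    using mult_left_mono[OF that, of "2 * \<tau>"] eta_tau tau_gt by simp
  have "oct_norm u 1 v = M"
  proof (rule oct_norm_eq_vertex_max[OF _ M_def])
    have "- \<eta> \<le> u \<or> v \<le> - u + 1 / (4 * u)"
      using n interior_I1I[of u v] by (meson not_le_imp_less)
    then show "0 \<le> 1 + 2 * \<tau> * u \<or> v - 1\<^sup>2 / (4 * u) \<le> M"
      using slope[of u] M by auto
    have "- \<eta> \<le> v \<or> u \<le> - v + 1 / (4 * v)"
      using n interior_I3I[of v u] by (meson not_le_imp_less)
    then show "0 \<le> 1 + 2 * \<tau> * v \<or> u - 1\<^sup>2 / (4 * v) \<le> M"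
      using slope[of v] M by auto
    show "\<delta> * 1 + \<tau> * u \<le> v \<or> \<delta> * 1 + \<tau> * v \<le> u \<or> (4 * u * v - 1\<^sup>2) / (2 * (u - 1 + v)) \<le> M"
    proof (rule ccontr)
      assume "\<not> ?thesis"
      then have l: "v < \<delta> + \<tau> * u" and r: "u < \<delta> + \<tau> * v"
        and K: "M < (4 * u * v - 1) / (2 * (u - 1 + v))"
        by auto
      have "(1 - \<tau>) * (u - 1 + v) = (u - \<delta> - \<tau> * v) + (v - \<delta> - \<tau> * u)"
        by (simp add: \<delta>_def field_simps)
      then have "(1 - \<tau>) * (u - 1 + v) < 0" using l r by linarith
      then have neg: "u - 1 + v < 0"
        using tau_lt by (simp add: mult_less_0_iff)
      \<comment> \<open>Multiplied by the negative denominator, these become the strict quadratic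
        inequalities of \<open>\<I>2\<close>.\<close>
      have "- u < (4 * u * v - 1) / (2 * (u - 1 + v))" "- v < (4 * u * v - 1) / (2 * (u - 1 + v))"
        using K M by linarith+
      then have "2 * u\<^sup>2 + 6 * u * v - 2 * u - 1 < 0" "2 * v\<^sup>2 + 6 * u * v - 2 * v - 1 < 0"
        using neg by (simp_all add: field_simps power2_eq_square)
      then show False using interior_I2I[OF l r] n by blast
    qed
  qed simp
  then show ?thesis by (simp only: M_def \<Phi>1_def \<Phi>3_def mult_1_right max.assoc max.commute max.left_commute)
qed

section \<open>Assembly of the cases for arbitrary coefficients\<close>

theorem corollary2p3:
  shows "(\<forall>a b c :: real.
      (b = 0 \<longrightarrow>
        oct_norm a b c = Max {\<bar>a\<bar>, \<bar>c\<bar>, \<bar>\<tau>\<^sup>2 * a + c\<bar>, \<bar>a + \<tau>\<^sup>2 * c\<bar>}) \<and>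
      (b \<noteq> 0 \<and> (a / b, c / b) \<in> \<I>1 \<longrightarrow> oct_norm a b c = \<Xi>1 a b c) \<and>
      (b \<noteq> 0 \<and> (a / b, c / b) \<in> \<I>2 \<longrightarrow> oct_norm a b c = \<Xi>2 a b c) \<and>
      (b \<noteq> 0 \<and> (a / b, c / b) \<in> \<I>3 \<longrightarrow> oct_norm a b c = \<Xi>3 a b c) \<and>
      (b \<noteq> 0 \<and> (a / b, c / b) \<in> \<E>1 \<longrightarrow> oct_norm a b c = \<Theta>1 a b c) \<and>
      (b \<noteq> 0 \<and> (a / b, c / b) \<in> \<E>3 \<longrightarrow> oct_norm a b c = \<Theta>3 a b c)) \<and>
    \<I>1 \<union> \<I>2 \<union> \<I>3 \<union> \<E>1 \<union> \<E>3 = UNIV"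
proof (intro conjI allI impI)
  fix a b c :: real
  show "oct_norm a b c = Max {\<bar>a\<bar>, \<bar>c\<bar>, \<bar>\<tau>\<^sup>2 * a + c\<bar>, \<bar>a + \<tau>\<^sup>2 * c\<bar>}" if "b = 0"
  proof -
    define M where "M = max (max \<bar>a\<bar> \<bar>c\<bar>) (max \<bar>a + \<tau> * 0 + \<tau>\<^sup>2 * c\<bar> \<bar>\<tau>\<^sup>2 * a + \<tau> * 0 + c\<bar>)"
    have M: "\<bar>a\<bar> \<le> M" "\<bar>c\<bar> \<le> M" by (simp_all add: M_def le_max_iff_disj)
    have "oct_norm a 0 c = M"
    proof (rule oct_norm_eq_vertex_max[OF _ M_def])
      \<comment> \<open>If both slope conditions fail, \<open>a\<close> and \<open>c\<close> are
        negative, so the critical value \<open>2 * a * c / (a + c)\<close> is nonpositive and cannot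
        exceed \<open>M\<close>.\<close>
      show "\<delta> * 0 + \<tau> * a \<le> c \<or> \<delta> * 0 + \<tau> * c \<le> a \<or> (4 * a * c - 0\<^sup>2) / (2 * (a - 0 + c)) \<le> M"
      proof (rule ccontr)
        assume "\<not> ?thesis"
        then have *: "c < \<tau> * a" "a < \<tau> * c" "M < 4 * a * c / (2 * (a + c))"
          by auto
        then have "(1 - \<tau>) * (a + c) < 0" by (simp add: algebra_simps)
        then have neg: "a + c < 0" using tau_lt by (simp add: mult_less_0_iff)
        have "a < 0"
        proof (rule ccontr)
          assume "\<not> a < 0"
          then have "c < 0" using neg by simp
          then have "\<tau> * c < 0" using tau_gt by (simp add: mult_less_0_iff)
          then show False using * \<open>\<not> a < 0\<close> by simp
        qed
        moreover from this have "\<tau> * a < 0" using tau_gt by (simp add: mult_less_0_iff)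
        then have "c < 0" using * by simp
        ultimately have "4 * a * c / (2 * (a + c)) \<le> 0"
          using neg by (intro divide_nonneg_nonpos) (auto simp: mult_nonpos_nonpos)
        then show False using * M by linarith
      qed
    qed (use M in auto)
    moreover have "Max {p, q, r, s} = max p (max q (max s r))" for p q r s :: real
      by (simp add: max.commute)
    ultimately show ?thesis
      by (simp only: that M_def mult_zero_right add_0_right max.assoc)
  qed
  \<comment> \<open>Scaling contributes \<open>\<bar>b\<bar>\<close>; splitting off
    \<open>sgn b\<close> leaves a factor \<open>b\<close> that clears the ratios
    \<open>a / b\<close> and \<open>c / b\<close>.\<close>
  have b: "\<bar>b\<bar> = sgn b * b" by (simp add: sgn_if)
  show "oct_norm a b c = \<Xi>1 a b c" if h: "b \<noteq> 0 \<and> (a / b, c / b) \<in> \<I>1"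
  proof -
    have "a \<noteq> 0" using h eta_eq tau_gt by (auto simp: \<I>1_def)
    then have "b * (c / b - 1 / (4 * (a / b))) = c - b\<^sup>2 / (4 * a)"
      using h by (simp add: field_simps power2_eq_square)
    then show ?thesis
      using oct_norm_scale[OF conjunct1[OF h] oct_norm_I1[OF conjunct2[OF h]]]
      by (simp only: \<Xi>1_def b mult.assoc)
  qed
  show "oct_norm a b c = \<Xi>3 a b c" if h: "b \<noteq> 0 \<and> (a / b, c / b) \<in> \<I>3"
  proof -
    have "c \<noteq> 0" using h eta_eq tau_gt by (auto simp: \<I>3_def)
    then have "b * (a / b - 1 / (4 * (c / b))) = a - b\<^sup>2 / (4 * c)"
      using h by (simp add: field_simps power2_eq_square)
    then show ?thesis
      using oct_norm_scale[OF conjunct1[OF h] oct_norm_I3[OF conjunct2[OF h]]]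
      by (simp only: \<Xi>3_def b mult.assoc)
  qed
  show "oct_norm a b c = \<Xi>2 a b c" if h: "b \<noteq> 0 \<and> (a / b, c / b) \<in> \<I>2"
  proof -
    have "\<bar>b\<bar> * \<Xi>2 (a / b) 1 (c / b) = \<Xi>2 a b c"
    proof (cases "a = b / 2 \<and> c = b / 2")
      case True
      then show ?thesis using h by (simp add: \<Xi>2_def)
    next
      case False
      then have F: "\<not> (a / b = 1 / 2 \<and> c / b = 1 / 2)" using h by (auto simp: field_simps)
      have num: "4 * (a / b) * (c / b) - 1\<^sup>2 = (4 * a * c - b\<^sup>2) / (b * b)"
        and den: "2 * (a / b - 1 + c / b) = 2 * (a - b + c) / b"
        using h by (simp_all add: field_simps power2_eq_square)
      have cancel: "x / (b * b) / (y / b) = x / y / b" for x y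
        using h by simp
      have "\<Xi>2 (a / b) 1 (c / b) = (4 * a * c - b\<^sup>2) / (2 * (a - b + c)) / b"
        by (simp only: \<Xi>2_def F if_False num den cancel sgn_1 mult_1_left)
      moreover have "\<Xi>2 a b c = sgn b * ((4 * a * c - b\<^sup>2) / (2 * (a - b + c)))"
        by (simp only: \<Xi>2_def False if_False)
      ultimately show ?thesis using h by (simp add: b)
    qed
    then show ?thesis using oct_norm_scale[OF conjunct1[OF h] oct_norm_I2[OF conjunct2[OF h]]] by simp
  qed
  have mx: "\<bar>b\<bar> * max \<bar>x\<bar> \<bar>y\<bar> = max \<bar>b * x\<bar> \<bar>b * y\<bar>" for x y
    by (simp add: max_mult_distrib_left abs_mult)
  show "oct_norm a b c = \<Theta>1 a b c" if h: "b \<noteq> 0 \<and> (a / b, c / b) \<in> \<E>1"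
  proof -
    have E: "(a / b, c / b) \<in> \<E>0" and le: "\<Phi>3 (a / b) (c / b) \<le> \<Phi>1 (a / b) (c / b)"
      using h by (auto simp: \<E>1_def)
    have "b * (c / b) = c" "b * (\<tau>\<^sup>2 * (a / b) + \<tau> + c / b) = \<tau>\<^sup>2 * a + \<tau> * b + c"
      using h by (simp_all add: field_simps)
    then have "\<bar>b\<bar> * \<Phi>1 (a / b) (c / b) = \<Theta>1 a b c"
      by (simp only: \<Phi>1_def \<Theta>1_def mx)
    then show ?thesis
      using oct_norm_scale[OF conjunct1[OF h] oct_norm_E0[OF E]] le by (simp only: max_absorb1)
  qed
  show "oct_norm a b c = \<Theta>3 a b c" if h: "b \<noteq> 0 \<and> (a / b, c / b) \<in> \<E>3"
  proof -
    have E: "(a / b, c / b) \<in> \<E>0" and le: "\<Phi>1 (a / b) (c / b) \<le> \<Phi>3 (a / b) (c / b)"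
      using h by (auto simp: \<E>3_def)
    have "b * (a / b) = a" "b * (a / b + \<tau> + \<tau>\<^sup>2 * (c / b)) = a + \<tau> * b + \<tau>\<^sup>2 * c"
      using h by (simp_all add: field_simps)
    then have "\<bar>b\<bar> * \<Phi>3 (a / b) (c / b) = \<Theta>3 a b c"
      by (simp only: \<Phi>3_def \<Theta>3_def mx)
    then show ?thesis
      using oct_norm_scale[OF conjunct1[OF h] oct_norm_E0[OF E]] le by (simp only: max_absorb2)
  qed
next
  \<comment> \<open>A point outside the three regions is outside their interiors, hence in
    \<open>\<E>0\<close>; comparing \<open>\<Phi>1\<close> with \<open>\<Phi>3\<close> then decides
    between \<open>\<E>1\<close> and \<open>\<E>3\<close>.\<close>
  show "\<I>1 \<union> \<I>2 \<union> \<I>3 \<union> \<E>1 \<union> \<E>3 = UNIV"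
    using interior_subset[of \<I>1] interior_subset[of \<I>2] interior_subset[of \<I>3]
    by (auto simp: \<E>0_def \<E>1_def \<E>3_def)
qed

end
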